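(* Let $(A,\mu,\alpha,\beta)$ be a BiHom-alternative algebra, with product written $xy=\mu(x,y)$, and let $R:A\to A$ be a Rota-Baxter operator of weight $0$ such that $R\alpha=\alpha R$ and $R\beta=\beta R$. Define $x\prec y=xR(y)$ and $x\succ y=R(x)y$ for all $x,y\in A$. Then $(A,\prec,\succ,\alpha,\beta)$ is a BiHom-pre-alternative algebra.
   Context: $\mathbb K$ is a field of characteristic $0$; all vector spaces are over $\mathbb K$. A BiHom-alternative algebra is a quadruple $(A,\mu,\alpha,\beta)$ with $A$ a vector space, $\mu:A\times A\to A$ bilinear (written $xy=\mu(x,y)$), $\alpha,\beta:A\to A$ linear with $\alpha\beta=\beta\alpha$, $\alpha(xy)=\alpha(x)\alpha(y)$, $\beta(xy)=\beta(x)\beta(y)$, such that, with $as_{\alpha,\beta}(x,y,z)=\alpha(x)(yz)-(xy)\beta(z)$, for all $x,y,z\in A$: $as_{\alpha,\beta}(\beta(x),\alpha(y),z)+as_{\alpha,\beta}(\beta(y),\alpha(x),z)=0$ and $as_{\alpha,\beta}(x,\beta(y),\alpha(z))+as_{\alpha,\beta}(x,\beta(z),\alpha(y))=0$. A Rota-Baxter operator of weight $0$ on it is a linear map $R:A\to A$ with $R(x)R(y)=R(R(x)y+xR(y))$ for all $x,y\in A$ (commuting with $\alpha$ and $\beta$). A BiHom-pre-alternative algebra is a tuple $(A,\prec,\succ,\alpha,\beta)$ with $A$ a vector space, $\prec,\succ:A\times A\to A$ bilinear, $\alpha,\beta:A\to A$ commuting linear maps, each multiplicative for both $\prec$ and $\succ$,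 such that, writing $x\circ y=x\prec y+x\succ y$ and $as^r_{\alpha,\beta}(x,y,z)=(x\prec y)\prec\beta(z)-\alpha(x)\prec(y\circ z)$, $as^m_{\alpha,\beta}(x,y,z)=(x\succ y)\prec\beta(z)-\alpha(x)\succ(y\prec z)$, $as^l_{\alpha,\beta}(x,y,z)=(x\circ y)\succ\beta(z)-\alpha(x)\succ(y\succ z)$, for all $x,y,z\in A$: - $as^r_{\alpha,\beta}(x,\beta(y),\alpha(z))+as^r_{\alpha,\beta}(x,\beta(z),\alpha(y))=0$; - $as^l_{\alpha,\beta}(\beta(x),\alpha(y),z)+as^l_{\alpha,\beta}(\beta(y),\alpha(x),z)=0$; - $as^m_{\alpha,\beta}(\beta(x),\alpha(y),z)+as^r_{\alpha,\beta}(\beta(y),\alpha(x),z)=0$; - $as^m_{\alpha,\beta}(x,\beta(y),\alpha(z))+as^l_{\alpha,\beta}(x,\beta(z),\alpha(y))=0$. *)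

theory Defs
  imports Complex_Main
begin

text \<open>
  A vector space over a field of characteristic zero is given by a scalar multiplication
  \<open>scale\<close> on a type whose scalars are in class \<open>field_char_0\<close>, so that the
  underlying space is the whole type. The prefix in \<open>Vector_Spaces.linear\<close> is needed
  because the short name refers to maps linear over the reals.
\<close>

definition bilinear_map ::
  "('k::field_char_0 \<Rightarrow> 'a::ab_group_add \<Rightarrow> 'a) \<Rightarrow> ('a \<Rightarrow> 'a \<Rightarrow> 'a) \<Rightarrow> bool" where
  "bilinear_map scale f \<longleftrightarrow>
     (\<forall>x. Vector_Spaces.linear scale scale (\<lambda>y. f x y)) \<and>
     (\<forall>y. Vector_Spaces.linear scale scale (\<lambda>x. f x y))"

definition bihom_associator ::
  "('a::ab_group_add \<Rightarrow> 'a \<Rightarrow> 'a) \<Rightarrow> ('a \<Rightarrow> 'a) \<Rightarrow> ('a \<Rightarrow> 'a) \<Rightarrow> 'a \<Rightarrow> 'a \<Rightarrow> 'a \<Rightarrow> 'a" where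
  "bihom_associator \<mu> \<alpha> \<beta> x y z = \<mu> (\<alpha> x) (\<mu> y z) - \<mu> (\<mu> x y) (\<beta> z)"

locale bihom_alternative_algebra = vector_space scale
  for scale :: "'k::field_char_0 \<Rightarrow> 'a::ab_group_add \<Rightarrow> 'a" +
  fixes \<mu> :: "'a \<Rightarrow> 'a \<Rightarrow> 'a"
    and \<alpha> \<beta> :: "'a \<Rightarrow> 'a"
  assumes bilinear_mult: "bilinear_map scale \<mu>"
    and linear_alpha: "Vector_Spaces.linear scale scale \<alpha>"
    and linear_beta: "Vector_Spaces.linear scale scale \<beta>"
    and alpha_beta_commute: "\<alpha> \<circ> \<beta> = \<beta> \<circ> \<alpha>"
    and alpha_mult: "\<alpha> (\<mu> x y) = \<mu> (\<alpha> x) (\<alpha> y)"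
    and beta_mult: "\<beta> (\<mu> x y) = \<mu> (\<beta> x) (\<beta> y)"
    and left_alternative:
      "bihom_associator \<mu> \<alpha> \<beta> (\<beta> x) (\<alpha> y) z + bihom_associator \<mu> \<alpha> \<beta> (\<beta> y) (\<alpha> x) z = 0"
    and right_alternative:
      "bihom_associator \<mu> \<alpha> \<beta> x (\<beta> y) (\<alpha> z) + bihom_associator \<mu> \<alpha> \<beta> x (\<beta> z) (\<alpha> y) = 0"

text \<open>
  Rota-Baxter operators of weight zero. Commutation with the structure maps is not part of
  this predicate, which only involves the product; it has to be assumed separately.
\<close>

definition rota_baxter_operator ::
  "('k::field_char_0 \<Rightarrow> 'a::ab_group_add \<Rightarrow> 'a) \<Rightarrow> ('a \<Rightarrow> 'a \<Rightarrow> 'a) \<Rightarrow> ('a \<Rightarrow> 'a) \<Rightarrow> bool" where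
  "rota_baxter_operator scale \<mu> R \<longleftrightarrow>
     Vector_Spaces.linear scale scale R \<and>
     (\<forall>x y. \<mu> (R x) (R y) = R (\<mu> (R x) y + \<mu> x (R y)))"

context
  fixes lt :: "'a::ab_group_add \<Rightarrow> 'a \<Rightarrow> 'a"  (infixl \<open>\<prec>\<close> 70)
    and gt :: "'a \<Rightarrow> 'a \<Rightarrow> 'a"  (infixl \<open>\<succ>\<close> 70)
begin

definition pre_sum :: "'a \<Rightarrow> 'a \<Rightarrow> 'a" where
  "pre_sum x y = x \<prec> y + x \<succ> y"

definition right_associator ::
  "('a \<Rightarrow> 'a) \<Rightarrow> ('a \<Rightarrow> 'a) \<Rightarrow> 'a \<Rightarrow> 'a \<Rightarrow> 'a \<Rightarrow> 'a" where
  "right_associator \<alpha> \<beta> x y z = (x \<prec> y) \<prec> \<beta> z - \<alpha> x \<prec> pre_sum y z"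

definition middle_associator ::
  "('a \<Rightarrow> 'a) \<Rightarrow> ('a \<Rightarrow> 'a) \<Rightarrow> 'a \<Rightarrow> 'a \<Rightarrow> 'a \<Rightarrow> 'a" where
  "middle_associator \<alpha> \<beta> x y z = (x \<succ> y) \<prec> \<beta> z - \<alpha> x \<succ> (y \<prec> z)"

definition left_associator ::
  "('a \<Rightarrow> 'a) \<Rightarrow> ('a \<Rightarrow> 'a) \<Rightarrow> 'a \<Rightarrow> 'a \<Rightarrow> 'a \<Rightarrow> 'a" where
  "left_associator \<alpha> \<beta> x y z = pre_sum x y \<succ> \<beta> z - \<alpha> x \<succ> (y \<succ> z)"

end

locale bihom_pre_alternative_algebra = vector_space scale
  for scale :: "'k::field_char_0 \<Rightarrow> 'a::ab_group_add \<Rightarrow> 'a" +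
  fixes lt :: "'a \<Rightarrow> 'a \<Rightarrow> 'a"  (infixl \<open>\<prec>\<close> 70)
    and gt :: "'a \<Rightarrow> 'a \<Rightarrow> 'a"  (infixl \<open>\<succ>\<close> 70)
    and \<alpha> \<beta> :: "'a \<Rightarrow> 'a"
  assumes bilinear_lt: "bilinear_map scale (\<prec>)"
    and bilinear_gt: "bilinear_map scale (\<succ>)"
    and linear_alpha: "Vector_Spaces.linear scale scale \<alpha>"
    and linear_beta: "Vector_Spaces.linear scale scale \<beta>"
    and alpha_beta_commute: "\<alpha> \<circ> \<beta> = \<beta> \<circ> \<alpha>"
    and alpha_lt: "\<alpha> (x \<prec> y) = \<alpha> x \<prec> \<alpha> y"
    and alpha_gt: "\<alpha> (x \<succ> y) = \<alpha> x \<succ> \<alpha> y"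
    and beta_lt: "\<beta> (x \<prec> y) = \<beta> x \<prec> \<beta> y"
    and beta_gt: "\<beta> (x \<succ> y) = \<beta> x \<succ> \<beta> y"
    and right_right:
      "right_associator (\<prec>) (\<succ>) \<alpha> \<beta> x (\<beta> y) (\<alpha> z)
         + right_associator (\<prec>) (\<succ>) \<alpha> \<beta> x (\<beta> z) (\<alpha> y) = 0"
    and left_left:
      "left_associator (\<prec>) (\<succ>) \<alpha> \<beta> (\<beta> x) (\<alpha> y) z
         + left_associator (\<prec>) (\<succ>) \<alpha> \<beta> (\<beta> y) (\<alpha> x) z = 0"
    and middle_right:
      "middle_associator (\<prec>) (\<succ>) \<alpha> \<beta> (\<beta> x) (\<alpha> y) z
         + right_associator (\<prec>) (\<succ>) \<alpha> \<beta> (\<beta> y) (\<alpha> x) z = 0"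
    and middle_left:
      "middle_associator (\<prec>) (\<succ>) \<alpha> \<beta> x (\<beta> y) (\<alpha> z)
         + left_associator (\<prec>) (\<succ>) \<alpha> \<beta> x (\<beta> z) (\<alpha> y) = 0"

end

theory Submission
  imports Defs
begin

text \<open>
  Each of the three associators of the split products \<open>x \<prec> y = x R(y)\<close> and
  \<open>x \<succ> y = R(x) y\<close> is, up to sign, the associator of the original product with \<open>R\<close>
  applied to two of the three arguments: all but the first for the right associator, all but
  the second for the middle one, all but the third for the left one. The Rota-Baxter identity
  says exactly that \<open>R\<close> sends \<open>x \<prec> y + x \<succ> y\<close> to \<open>R(x) R(y)\<close>, which
  removes the nested \<open>R\<close> in the right and left associators.

  The pre-alternative axioms are then instances of the two alternative laws. Where two
  different associators occur together, they leave the same variable undecorated: both terms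
  of \<open>middle_right\<close> leave \<open>y\<close> bare, and the identity is left alternativity at
  \<open>(R x, y, R z)\<close>; both terms of \<open>middle_left\<close> leave \<open>y\<close> bare, and the identity is
  right alternativity at the same triple. In every case \<open>R\<close> must be moved past the structure
  maps, hence the commutation hypotheses.
\<close>

lemma rota_baxter_pre_sum:
  assumes "rota_baxter_operator scale \<mu> R"
  shows "R (pre_sum (\<lambda>x y. \<mu> x (R y)) (\<lambda>x y. \<mu> (R x) y) x y) = \<mu> (R x) (R y)"
  using assms by (simp add: rota_baxter_operator_def pre_sum_def add.commute)

text \<open>
  In each associator the structure map on an outer argument carrying \<open>R\<close> appears inside
  \<open>R\<close> on the left and outside it on the right; here it is \<open>\<beta>\<close> on \<open>z\<close>.
\<close>

lemma right_associator_rota_baxter: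
  assumes "rota_baxter_operator scale \<mu> R" and "\<And>x. R (\<beta> x) = \<beta> (R x)"
  shows "right_associator (\<lambda>x y. \<mu> x (R y)) (\<lambda>x y. \<mu> (R x) y) \<alpha> \<beta> x y z
    = - bihom_associator \<mu> \<alpha> \<beta> x (R y) (R z)"
  by (simp add: right_associator_def bihom_associator_def
      rota_baxter_pre_sum[OF assms(1)] assms(2))

lemma middle_associator_split:
  assumes "\<And>x. R (\<alpha> x) = \<alpha> (R x)" and "\<And>x. R (\<beta> x) = \<beta> (R x)"
  shows "middle_associator (\<lambda>x y. \<mu> x (R y)) (\<lambda>x y. \<mu> (R x) y) \<alpha> \<beta> x y z
    = - bihom_associator \<mu> \<alpha> \<beta> (R x) y (R z)"
  by (simp add: middle_associator_def bihom_associator_def assms)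

lemma left_associator_rota_baxter:
  assumes "rota_baxter_operator scale \<mu> R" and "\<And>x. R (\<alpha> x) = \<alpha> (R x)"
  shows "left_associator (\<lambda>x y. \<mu> x (R y)) (\<lambda>x y. \<mu> (R x) y) \<alpha> \<beta> x y z
    = - bihom_associator \<mu> \<alpha> \<beta> (R x) (R y) z"
  by (simp add: left_associator_def bihom_associator_def
      rota_baxter_pre_sum[OF assms(1)] assms(2))

lemma bilinear_map_compose_right:
  assumes "bilinear_map scale f" and "Vector_Spaces.linear scale scale g"
  shows "bilinear_map scale (\<lambda>x y. f x (g y))"
  using assms Vector_Spaces.linear_compose[OF assms(2)]
  unfolding bilinear_map_def o_def by blast

lemma bilinear_map_compose_left:
  assumes "bilinear_map scale f" and "Vector_Spaces.linear scale scale g"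
  shows "bilinear_map scale (\<lambda>x y. f (g x) y)"
  using assms Vector_Spaces.linear_compose[OF assms(2)]
  unfolding bilinear_map_def o_def by blast

theorem corollary1p3:
  fixes scale :: "'k::field_char_0 \<Rightarrow> 'a::ab_group_add \<Rightarrow> 'a"
    and \<mu> :: "'a \<Rightarrow> 'a \<Rightarrow> 'a"
    and \<alpha> \<beta> R :: "'a \<Rightarrow> 'a"
  assumes "bihom_alternative_algebra scale \<mu> \<alpha> \<beta>"
    and "rota_baxter_operator scale \<mu> R"
    and "R \<circ> \<alpha> = \<alpha> \<circ> R"
    and "R \<circ> \<beta> = \<beta> \<circ> R"
  shows "bihom_pre_alternative_algebra scale (\<lambda>x y. \<mu> x (R y)) (\<lambda>x y. \<mu> (R x) y) \<alpha> \<beta>"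
proof -
  interpret bihom_alternative_algebra scale \<mu> \<alpha> \<beta> by (fact assms(1))
  have lin: "Vector_Spaces.linear scale scale R"
    using assms(2) by (simp add: rota_baxter_operator_def)
  have Ra: "R (\<alpha> x) = \<alpha> (R x)" and Rb: "R (\<beta> x) = \<beta> (R x)" for x
    using assms(3,4) by (simp_all add: fun_eq_iff)
  note associators = right_associator_rota_baxter[where R = R and \<beta> = \<beta>, OF assms(2) Rb]
    middle_associator_split[where R = R and \<alpha> = \<alpha> and \<beta> = \<beta>, OF Ra Rb]
    left_associator_rota_baxter[where R = R and \<alpha> = \<alpha>, OF assms(2) Ra]
  have neg_sum: "- a + - b = 0" if "a + b = 0" for a b :: 'a
    using that by (simp add: add_eq_0_iff)
  show ?thesis
  proof (intro bihom_pre_alternative_algebra.intro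
      bihom_pre_alternative_algebra_axioms.intro, unfold associators Ra Rb)
    show "bilinear_map scale (\<lambda>x y. \<mu> x (R y))"
      by (rule bilinear_map_compose_right[OF bilinear_mult lin])
    show "bilinear_map scale (\<lambda>x y. \<mu> (R x) y)"
      by (rule bilinear_map_compose_left[OF bilinear_mult lin])
  qed (rule vector_space_axioms linear_alpha linear_beta alpha_beta_commute alpha_mult beta_mult
      neg_sum[OF left_alternative] neg_sum[OF right_alternative])+
qed

end
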